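(* Let $n=mk$ and consider a Desarguesian spread code $\mathcal{S}_q(m,k,P)\subseteq\mathcal{G}_q(k,n)$. Denote the number of correctable erasure patterns for the row erasure channel by $$r(n,k)=2^{kn}-(2^n-1)^k,$$ and denote the average number of correctable erasure patterns for the column erasure channel by $$e_{\rm avg}(n,k)=\frac{N^m}{q^n-1}\Big(q^n-\Big[\frac{(q^k-1)(N-1)}{N}+1\Big]^m\Big),\qquad\text{where } N=2^{k^2}-(2^k-1)^k.$$ Then $$\frac{r(n,k)}{e_{\rm avg}(n,k)}\le kN\Big(\frac{2^{(k-1)k}}{N}\Big)^m .$$ As a consequence, for any fixed $k$ we have $$\lim_{m\to\infty}\frac{r(n,k)}{e_{\rm avg}(n,k)}=0 .$$
   Context: $q$ is a prime power, $m,k$ are positive integers, and $\mathcal{G}_q(k,n)$ is the set of $k$-dimensional subspaces of $\mathbb{F}_q^n$. For $P\in\mathrm{GL}_k(q)$ the companion matrix of a monic irreducible polynomial of degree $k$ over $\mathbb{F}_q$, the Desarguesian spread code $\mathcal{S}_q(m,k,P)$ is the set of row spaces of all $k\times mk$ matrices $(0\mid\cdots\mid 0\mid I_k\mid B_{i+1}\mid\cdots\mid B_m)$ with $1\le i\le m$, $I_k$ in the $i$-th block, and $B_j\in\mathbb{F}_q[P]$. An erasure pattern is a matrix in $\{0,?\}^{k\times n}$, where $?$ marks an erased symbol (the zero matrix is included in counts). In the row erasure channel each received row containing an erasure is deleted; in the column erasure channel each column containing an erasure is completely erased. The average for the column erasure channel is over the codewords of the spread code, and the formula for $e_{\rm avg}$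 counts those patterns for which at least one nonzero block of the sent matrix is unaffected by erasures and every block has at most $k-1$ affected columns. The inequality and the limit only involve the explicit formulas given in the claim; in the limit, $n=mk$.
   Formalization: The limit is proved only for k ≥ 2, since for k = 1 it is false: then N = 1, r(n,1) = 1 and e_avg(n,1) = 1, so the ratio is constantly 1; the two formulas and the inequality are proved for all k ≥ 1. *)

theory Defs
  imports
    "HOL-Computational_Algebra.Polynomial_Factorial"
    "Jordan_Normal_Form.VS_Connect"
    "HOL-Library.Cardinality"
    Complex_Main
begin

definition companion_mat :: "'a::field poly \<Rightarrow> 'a mat" where
  "companion_mat f = mat (degree f) (degree f)
     (\<lambda>(i, j). if Suc i < degree f then (if j = Suc i then 1 else 0) else - coeff f j)"

definition poly_eval_mat :: "nat \<Rightarrow> 'a::field mat \<Rightarrow> 'a poly \<Rightarrow> 'a mat" where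
  "poly_eval_mat k P g =
     mat k k (\<lambda>(r, c). \<Sum>l\<le>degree g. coeff g l * (P ^\<^sub>m l) $$ (r, c))"

text \<open>The matrix algebra $F_q[P]$.\<close>

definition mat_algebra :: "nat \<Rightarrow> 'a::field mat \<Rightarrow> 'a mat set" where
  "mat_algebra k P = range (poly_eval_mat k P)"

text \<open>Blocks are numbered from 0: block \<open>j\<close> consists of the columns
  \<open>j * k, \<dots>, j * k + k - 1\<close>.\<close>

definition block_row :: "nat \<Rightarrow> nat \<Rightarrow> (nat \<Rightarrow> 'a mat) \<Rightarrow> 'a mat" where
  "block_row m k B = mat k (m * k) (\<lambda>(r, c). B (c div k) $$ (r, c mod k))"

definition block :: "nat \<Rightarrow> 'a mat \<Rightarrow> nat \<Rightarrow> 'a mat" where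
  "block k M j = mat k k (\<lambda>(r, c). M $$ (r, j * k + c))"

definition spread_matrices :: "nat \<Rightarrow> nat \<Rightarrow> 'a::field mat \<Rightarrow> 'a mat set" where
  "spread_matrices m k P = {block_row m k B | B i. i < m \<and>
     (\<forall>j<i. B j = 0\<^sub>m k k) \<and> B i = 1\<^sub>m k \<and>
     (\<forall>j. i < j \<and> j < m \<longrightarrow> B j \<in> mat_algebra k P)}"

definition mat_row_space :: "'a::field mat \<Rightarrow> 'a vec set" where
  "mat_row_space M = vec_space.row_space (dim_col M) M"

definition spread_code :: "nat \<Rightarrow> nat \<Rightarrow> 'a::field mat \<Rightarrow> 'a vec set set" where
  "spread_code m k P = mat_row_space ` spread_matrices m k P"

text \<open>The matrix transmitted for a codeword. The matrices in \<^term>\<open>spread_matrices m k P\<close> are in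
  reduced row echelon form, so each codeword has exactly one of them as generator matrix.\<close>

definition sent_matrix :: "nat \<Rightarrow> nat \<Rightarrow> 'a::field mat \<Rightarrow> 'a vec set \<Rightarrow> 'a mat" where
  "sent_matrix m k P U = (THE M. M \<in> spread_matrices m k P \<and> mat_row_space M = U)"

text \<open>A matrix over $\{0,?\}$ is represented by the set of positions of its entries \<open>?\<close>;
  the zero matrix is the empty set.\<close>

definition erasure_patterns :: "nat \<Rightarrow> nat \<Rightarrow> (nat \<times> nat) set set" where
  "erasure_patterns k n = Pow ({..<k} \<times> {..<n})"

definition received_rows :: "(nat \<times> nat) set \<Rightarrow> 'a mat \<Rightarrow> 'a vec set" where
  "received_rows E M = {row M i | i. i < dim_row M \<and> (\<forall>j<dim_col M. (i, j) \<notin> E)}"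

text \<open>Over the row channel a pattern is correctable if, whichever codeword is sent, something is
  received and the received rows lie in no other codeword. The requirement that some row arrives
  is implied by the second condition when the code has at least two codewords; for \<open>m = 1\<close>,
  where there is only one, it excludes the patterns that delete all rows.\<close>

definition row_correctable :: "nat \<Rightarrow> nat \<Rightarrow> 'a::field mat \<Rightarrow> (nat \<times> nat) set \<Rightarrow> bool" where
  "row_correctable m k P E \<longleftrightarrow>
     (\<forall>U \<in> spread_code m k P.
        received_rows E (sent_matrix m k P U) \<noteq> {} \<and>
        (\<forall>V \<in> spread_code m k P. received_rows E (sent_matrix m k P U) \<subseteq> V \<longrightarrow> V = U))"

definition num_row_correctable :: "nat \<Rightarrow> nat \<Rightarrow> 'a::field mat \<Rightarrow> nat" where
  "num_row_correctable m k P = card {E \<in> erasure_patterns k (m * k). row_correctable m k P E}"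

definition affected_columns :: "nat \<Rightarrow> (nat \<times> nat) set \<Rightarrow> nat \<Rightarrow> nat set" where
  "affected_columns k E j = {c. c div k = j \<and> (\<exists>i. (i, c) \<in> E)}"

text \<open>Over the column channel correctability depends on the codeword sent: some nonzero block
  of its matrix arrives intact, and no block is erased completely.\<close>

definition column_correctable ::
    "nat \<Rightarrow> nat \<Rightarrow> 'a::field mat \<Rightarrow> 'a vec set \<Rightarrow> (nat \<times> nat) set \<Rightarrow> bool" where
  "column_correctable m k P U E \<longleftrightarrow>
     (\<exists>j<m. block k (sent_matrix m k P U) j \<noteq> 0\<^sub>m k k \<and> affected_columns k E j = {}) \<and>
     (\<forall>j<m. card (affected_columns k E j) \<le> k - 1)"

definition avg_column_correctable :: "nat \<Rightarrow> nat \<Rightarrow> 'a::field mat \<Rightarrow> real" where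
  "avg_column_correctable m k P =
     (\<Sum>U \<in> spread_code m k P.
        real (card {E \<in> erasure_patterns k (m * k). column_correctable m k P U E}))
     / real (card (spread_code m k P))"

end

theory Submission
  imports Defs
begin

text \<open>
  Identify row vectors of length \<open>k\<close> with polynomials modulo \<open>f\<close>; then a matrix \<open>g(P)\<close> acts from the
  right as multiplication by \<open>g\<close>. Since \<open>f\<close> is irreducible, the matrices \<open>g(P)\<close> form a field of \<open>q^k\<close>
  elements, and two codewords sharing a nonzero vector coincide. Hence one surviving row determines
  the codeword, and over the row channel only the patterns affecting every row fail.

  For the column channel the \<open>m\<close> blocks are independent: \<open>N\<close> patterns leave a block partially intact
  and \<open>N - 1\<close> of them hit it. A codeword with \<open>t\<close> nonzero blocks has \<open>N^m - (N - 1)^t N^(m - t)\<close>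
  correctable patterns. Sorting the codewords by the position of the leading identity block turns
  both the sum of these numbers and the number of codewords into geometric sums.

  With \<open>Q = q^k\<close> and \<open>A = Q - (Q - 1)/N \<ge> 1\<close>, factoring both differences of powers gives
  \<open>Q^m - 1 \<le> N (Q^m - A^m)\<close>, while \<open>a^k - (a - 1)^k \<le> k a^(k - 1)\<close> for \<open>a = 2^n\<close> bounds the row count.
  The limit follows from \<open>N > 2^((k - 1) k)\<close>, which holds for \<open>k \<ge> 2\<close>.
\<close>

subsection \<open>Differences of powers\<close>

text \<open>With \<open>k = Suc l\<close> the claim rearranges to
  \<open>(a - 1) * (a - 1) ^ l < (a - 1) * a ^ l\<close>, which is strict since \<open>l\<close> is
  positive; at \<open>k = 1\<close> both sides would be 1. At \<open>a = 2 ^ k\<close> it makes the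
  base of the final bound less than 1.\<close>

lemma power_diff_gt:
  fixes a :: real
  assumes "2 \<le> k" "2 \<le> a"
  shows "a ^ (k - 1) < a ^ k - (a - 1) ^ k"
proof -
  obtain l where k: "k = Suc l" "l \<noteq> 0" using assms by (cases k) auto
  have "(a - 1) ^ l < a ^ l" using assms k by (intro power_strict_mono) auto
  hence "(a - 1) * (a - 1) ^ l < (a - 1) * a ^ l" using assms by simp
  thus ?thesis by (simp add: k algebra_simps)
qed

text \<open>Factoring the difference leaves \<open>k\<close> summands, each at most
  \<open>a ^ (k - 1)\<close>.\<close>

lemma power_diff_le:
  fixes a :: real
  assumes "1 \<le> a"
  shows "a ^ k - (a - 1) ^ k \<le> k * a ^ (k - 1)"
proof -
  have "a ^ k - (a - 1) ^ k = (\<Sum>i<k. (a - 1) ^ (k - Suc i) * a ^ i)"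
    by (simp add: power_diff_sumr2)
  also have "\<dots> \<le> (\<Sum>i<k. a ^ (k - Suc i) * a ^ i)"
    using assms by (intro sum_mono mult_right_mono power_mono) auto
  also have "\<dots> = (\<Sum>i<k. a ^ (k - 1))"
    by (intro sum.cong refl) (simp flip: power_add)
  finally show ?thesis by simp
qed

text \<open>With \<open>A\<close> the base of the subtracted power, the linear factors match by
  \<open>N * (Q - A) = Q - 1\<close>, and the cofactor only grows when the base 1 is replaced by
  \<open>A\<close>.\<close>

lemma geometric_comparison:
  fixes Q N :: real
  assumes "1 < Q" "1 \<le> N"
  shows "Q ^ m - 1 \<le> N * (Q ^ m - ((Q - 1) * (N - 1) / N + 1) ^ m)"
proof -
  define A where "A = (Q - 1) * (N - 1) / N + 1"
  have A: "1 \<le> A" "N * (Q - A) = Q - 1"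
    using assms by (auto simp: A_def, simp add: field_simps)
  have "Q ^ m - 1 = (Q - 1) * (\<Sum>i<m. 1 ^ (m - Suc i) * Q ^ i)"
    using power_diff_sumr2[of Q m 1] by simp
  also have "\<dots> \<le> (Q - 1) * (\<Sum>i<m. A ^ (m - Suc i) * Q ^ i)"
    using assms A by (intro mult_left_mono sum_mono mult_right_mono power_mono) auto
  also have "\<dots> = N * (Q ^ m - A ^ m)"
    by (simp add: power_diff_sumr2 A(2)[symmetric] mult_ac)
  finally show ?thesis by (simp add: A_def)
qed

subsection \<open>Counting erasure patterns\<close>

lemma real_card_Diff_subset:
  "finite A \<Longrightarrow> B \<subseteq> A \<Longrightarrow> real (card (A - B)) = real (card A) - real (card B)"
  using finite_subset[of B A] by (simp add: card_Diff_subset card_mono of_nat_diff)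

text \<open>A subset of a disjoint union is the same as the family of its traces on the parts, so
  conditions on separate parts are independent and their counts multiply.\<close>

lemma card_local_subsets:
  assumes "finite I" "disjoint_family_on C I" "\<And>j. j \<in> I \<Longrightarrow> D j \<subseteq> Pow (C j)"
  shows "card {E. E \<subseteq> (\<Union>j\<in>I. C j) \<and> (\<forall>j\<in>I. E \<inter> C j \<in> D j)} = (\<Prod>j\<in>I. card (D j))"
proof -
  have *: "(\<Union>j\<in>I. X j) \<inter> C i = X i" if "X \<in> PiE I D" "i \<in> I" for X i
  proof -
    have "X j \<subseteq> C j" if "j \<in> I" for j using that \<open>X \<in> PiE I D\<close> assms(3) by (auto simp: PiE_iff)
    thus ?thesis using assms(2) \<open>i \<in> I\<close> unfolding disjoint_family_on_def by fastforce
  qed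
  have bij: "bij_betw (\<lambda>E. \<lambda>j\<in>I. E \<inter> C j)
      {E. E \<subseteq> (\<Union>j\<in>I. C j) \<and> (\<forall>j\<in>I. E \<inter> C j \<in> D j)} (PiE I D)"
  proof (rule bij_betwI[where g = "\<lambda>X. \<Union>j\<in>I. X j"])
    show "(\<lambda>X. \<Union>j\<in>I. X j) \<in> PiE I D \<rightarrow> {E. E \<subseteq> (\<Union>j\<in>I. C j) \<and> (\<forall>j\<in>I. E \<inter> C j \<in> D j)}"
    proof
      fix X assume X: "X \<in> PiE I D"
      moreover from this have "X j \<subseteq> C j" if "j \<in> I" for j
        using that assms(3) by (auto simp: PiE_iff)
      ultimately show "(\<Union>j\<in>I. X j) \<in> {E. E \<subseteq> (\<Union>j\<in>I. C j) \<and> (\<forall>j\<in>I. E \<inter> C j \<in> D j)}"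
        using *[OF X] by (auto simp: PiE_iff)
    qed
    show "(\<lambda>j\<in>I. (\<Union>j\<in>I. X j) \<inter> C j) = X" if X: "X \<in> PiE I D" for X
      using *[OF X] X by (auto simp: restrict_def PiE_def extensional_def fun_eq_iff)
  qed auto
  show ?thesis by (simp add: bij_betw_same_card[OF bij] card_PiE assms(1))
qed

text \<open>The index sets are arbitrary, so that the same count serves a single block and, after
  transposition, the rows of the whole grid.\<close>

definition full_columns :: "'a set \<Rightarrow> 'b set \<Rightarrow> ('a \<times> 'b) set set" where
  "full_columns R C = {E. E \<subseteq> R \<times> C \<and> C \<subseteq> snd ` E}"

text \<open>Each column independently carries any nonempty subset of its cells.\<close>

lemma card_full_columns:
  assumes "finite R" "finite C"
  shows "card (full_columns R C) = (2 ^ card R - 1) ^ card C"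
proof -
  have "full_columns R C = {E. E \<subseteq> (\<Union>c\<in>C. R \<times> {c}) \<and>
      (\<forall>c\<in>C. E \<inter> R \<times> {c} \<in> Pow (R \<times> {c}) - {{}})}"
    unfolding full_columns_def by (intro Collect_cong) force
  also have "card \<dots> = (\<Prod>c\<in>C. card (Pow (R \<times> {c}) - {{}}))"
    by (rule card_local_subsets) (use assms in \<open>auto simp: disjoint_family_on_def\<close>)
  also have "\<dots> = (2 ^ card R - 1) ^ card C"
    using assms by (simp add: card_Pow card_cartesian_product)
  finally show ?thesis .
qed

lemma card_full_rows:
  assumes "finite R" "finite C"
  shows "card {E. E \<subseteq> R \<times> C \<and> R \<subseteq> fst ` E} = (2 ^ card C - 1) ^ card R"
proof -
  have bij: "bij_betw converse {E. E \<subseteq> R \<times> C \<and> R \<subseteq> fst ` E} (full_columns C R)"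
    by (rule bij_betwI[where g = converse]) (force simp: full_columns_def)+
  show ?thesis using assms by (simp add: bij_betw_same_card[OF bij] card_full_columns)
qed

subsection \<open>The matrix algebra of a companion matrix\<close>

text \<open>Multiplication by \<open>X\<close> raises the degree by at most one, so a single
  subtraction of a multiple of the monic \<open>f\<close> completes the reduction.\<close>

lemma coeff_X_mult_mod:
  fixes f h :: "'a::field poly"
  assumes "lead_coeff f = 1" "0 < degree f" "degree h < degree f"
  shows "(pCons 0 h) mod f = pCons 0 h - Polynomial.smult (coeff h (degree f - 1)) f"
proof -
  let ?a = "coeff h (degree f - 1)" and ?r = "pCons 0 h - Polynomial.smult (coeff h (degree f - 1)) f"
  have f0: "f \<noteq> 0" using assms by auto
  have "degree ?r \<le> degree f"
    using assms by (intro degree_diff_le) (auto simp: degree_pCons_eq_if)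
  moreover have "coeff ?r (degree f) = 0"
    using assms by (auto simp: coeff_pCons split: nat.split)
  ultimately have "degree ?r < degree f"
    using assms(2) by (metis coeff_0_degree_minus_1 degree_0 leading_coeff_0_iff le_neq_implies_less)
  hence "?r mod f = ?r" by (rule mod_poly_less)
  moreover have "?r mod f = pCons 0 h mod f"
    by (simp add: poly_mod_diff_left mod_smult_left)
  ultimately show ?thesis by simp
qed

context
  fixes f :: "'a::field poly" and P :: "'a mat" and k :: nat
  assumes monic: "lead_coeff f = 1" and kpos: "0 < k" and deg: "degree f = k"
    and P: "P = companion_mat f"
begin

lemma dim_companion: "P \<in> carrier_mat k k"
  by (simp add: P companion_mat_def deg)

text \<open>Row \<open>r\<close> of \<open>P ^ l\<close> is the coefficient vector of \<open>X ^ (r + l)\<close> modulo \<open>f\<close>: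
  right multiplication by \<open>P\<close> is multiplication by \<open>X\<close> in the quotient ring.\<close>

lemma companion_pow_entry:
  assumes "r < k" "c < k"
  shows "(P ^\<^sub>m l) $$ (r, c) = coeff (monom 1 (r + l) mod f) c"
  using assms(2)
proof (induction l arbitrary: c)
  case 0
  have "monom 1 r mod f = monom 1 r"
    using assms by (intro mod_poly_less) (simp add: deg degree_monom_eq)
  thus ?case using 0 assms dim_companion by simp
next
  case (Suc l)
  define h where "h = monom 1 (r + l) mod f"
  have f0: "f \<noteq> 0" using monic by auto
  have h: "degree h < k"
    using degree_mod_less[OF f0, of "monom 1 (r + l)"] kpos by (auto simp: h_def deg)
  have dim: "P ^\<^sub>m l \<in> carrier_mat k k" using dim_companion by simp
  have "(P ^\<^sub>m Suc l) $$ (r, c) = (\<Sum>j<k. coeff h j * P $$ (j, c))"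
    using dim dim_companion assms(1) Suc
    by (auto simp: scalar_prod_def h_def lessThan_atLeast0 intro!: sum.cong)
  \<comment> \<open>The first \<open>k - 1\<close> rows of \<open>P\<close> shift the coefficients
    of \<open>h\<close>; the last row subtracts \<open>coeff h (k - 1)\<close> times
    \<open>f\<close>. Together this is the reduction of \<open>X * h\<close> modulo
    \<open>f\<close>.\<close>
  also have "\<dots> = (\<Sum>j<k - 1. coeff h j * P $$ (j, c)) + coeff h (k - 1) * P $$ (k - 1, c)"
    using kpos by (cases k) auto
  also have "P $$ (k - 1, c) = - coeff f c"
    using kpos Suc.prems by (simp add: P companion_mat_def deg)
  also have "(\<Sum>j<k - 1. coeff h j * P $$ (j, c)) = (\<Sum>j<k - 1. if Suc j = c then coeff h j else 0)"
    using Suc.prems by (intro sum.cong refl) (auto simp: P companion_mat_def deg)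
  also have "\<dots> = coeff (pCons 0 h) c"
    using Suc.prems by (cases c) (auto simp: coeff_pCons sum.delta)
  also have "coeff (pCons 0 h) c + coeff h (k - 1) * - coeff f c = coeff (pCons 0 h mod f) c"
    using coeff_X_mult_mod[OF monic] h kpos deg by simp
  also have "pCons 0 h mod f = pCons 0 (monom 1 (r + l)) mod f"
    using mod_mult_right_eq[of "[:0, 1:]" "monom 1 (r + l)" f] by (simp add: h_def)
  finally show ?case by (simp add: monom_Suc)
qed

text \<open>Linearity of reduction modulo \<open>f\<close> extends
  \<open>companion_pow_entry\<close> from powers to all polynomials.\<close>

lemma poly_eval_mat_entry:
  assumes "r < k" "c < k"
  shows "poly_eval_mat k P g $$ (r, c) = coeff ((monom 1 r * g) mod f) c"
proof -
  have "monom 1 r * g = (\<Sum>l\<le>degree g. Polynomial.smult (coeff g l) (monom 1 (r + l)))"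
    by (subst (1) poly_as_sum_of_monoms[of g, symmetric])
      (simp add: sum_distrib_left mult_monom smult_monom)
  moreover have "coeff ((\<Sum>l\<le>n. Polynomial.smult (coeff g l) (monom 1 (r + l))) mod f) c
      = (\<Sum>l\<le>n. coeff g l * coeff (monom 1 (r + l) mod f) c)" for n
    by (induction n) (simp_all add: poly_mod_add_left mod_smult_left)
  ultimately show ?thesis
    using assms by (simp add: poly_eval_mat_def companion_pow_entry)
qed

lemma poly_mod_eqI:
  assumes "\<And>c. c < k \<Longrightarrow> coeff (g mod f) c = coeff (h mod f) c"
  shows "g mod f = h mod f"
proof (rule poly_eqI)
  fix c
  have "coeff (p mod f) c = 0" if "k \<le> c" for p
    using that degree_mod_less[of f p] monic kpos deg
    by (metis coeff_0 coeff_eq_0 leading_coeff_0_iff order_less_le_trans zero_neq_one)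
  thus "coeff (g mod f) c = coeff (h mod f) c" using assms[of c] by (cases "c < k") auto
qed

text \<open>Row 0 of \<open>g(P)\<close> already is \<open>g mod f\<close>, and this residue
  determines the other rows. The matrix algebra is thus a copy of the quotient ring modulo
  \<open>f\<close>.\<close>

lemma poly_eval_mat_eq_iff:
  "poly_eval_mat k P g = poly_eval_mat k P h \<longleftrightarrow> g mod f = h mod f"
proof
  assume eq: "poly_eval_mat k P g = poly_eval_mat k P h"
  show "g mod f = h mod f"
  proof (rule poly_mod_eqI)
    fix c assume "c < k"
    thus "coeff (g mod f) c = coeff (h mod f) c"
      using arg_cong[OF eq, of "\<lambda>X. X $$ (0, c)"] kpos by (simp add: poly_eval_mat_entry)
  qed
next
  assume "g mod f = h mod f"
  hence "(p * g) mod f = (p * h) mod f" for p by (metis mod_mult_right_eq)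
  moreover have "poly_eval_mat k P g \<in> carrier_mat k k" "poly_eval_mat k P h \<in> carrier_mat k k"
    by (simp_all add: poly_eval_mat_def)
  ultimately show "poly_eval_mat k P g = poly_eval_mat k P h"
    by (intro eq_matI) (auto simp: poly_eval_mat_entry)
qed

lemma zero_mat_in_algebra: "0\<^sub>m k k \<in> mat_algebra k P"
proof -
  have "poly_eval_mat k P 0 = 0\<^sub>m k k" by (rule eq_matI) (auto simp: poly_eval_mat_def)
  thus ?thesis unfolding mat_algebra_def by (metis rangeI)
qed

text \<open>Every residue class has exactly one representative of degree below \<open>k\<close>, and
  its \<open>k\<close> coefficients are arbitrary.\<close>

lemma card_mat_algebra: "card (mat_algebra k P) = CARD('a) ^ k"
proof -
  let ?L = "{g :: 'a poly. degree g < k}"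
  have f0: "f \<noteq> 0" using monic by auto
  have "mat_algebra k P = poly_eval_mat k P ` ?L"
  proof -
    have "poly_eval_mat k P g \<in> poly_eval_mat k P ` ?L" for g
    proof
      show "poly_eval_mat k P g = poly_eval_mat k P (g mod f)" by (simp add: poly_eval_mat_eq_iff)
      show "g mod f \<in> ?L" using degree_mod_less[OF f0, of g] kpos by (auto simp: deg)
    qed
    thus ?thesis unfolding mat_algebra_def by blast
  qed
  moreover have "inj_on (poly_eval_mat k P) ?L"
    by (auto simp: inj_on_def poly_eval_mat_eq_iff mod_poly_less deg)
  moreover have bij: "bij_betw (\<lambda>g. restrict (coeff g) {..<k}) ?L ({..<k} \<rightarrow>\<^sub>E (UNIV :: 'a set))"
  proof (rule bij_betwI[where g = "\<lambda>x. \<Sum>i<k. monom (x i) i"])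
    show "(\<lambda>x. \<Sum>i<k. monom (x i) i) \<in> ({..<k} \<rightarrow>\<^sub>E (UNIV :: 'a set)) \<rightarrow> ?L"
    proof
      fix x :: "nat \<Rightarrow> 'a"
      have "degree (\<Sum>i<k. monom (x i) i) \<le> k - 1"
        by (intro degree_sum_le) (auto intro: order_trans[OF degree_monom_le])
      thus "(\<Sum>i<k. monom (x i) i) \<in> ?L" using kpos by simp
    qed
    show "(\<Sum>i<k. monom (restrict (coeff g) {..<k} i) i) = g" if "g \<in> ?L" for g
      using that by (intro poly_eqI) (auto simp: coeff_sum coeff_eq_0)
    show "restrict (coeff (\<Sum>i<k. monom (x i) i)) {..<k} = x" if "x \<in> {..<k} \<rightarrow>\<^sub>E UNIV" for x :: "nat \<Rightarrow> 'a"
      using that by (auto simp: fun_eq_iff coeff_sum restrict_def PiE_def extensional_def)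
  qed auto
  ultimately show ?thesis
    using bij_betw_same_card[OF bij] by (simp add: card_image card_PiE)
qed

text \<open>Identifying row vectors with polynomials modulo \<open>f\<close>, this is cancellation in a field.\<close>

lemma mat_algebra_left_cancel:
  assumes irred: "irreducible f"
    and X: "X \<in> mat_algebra k P" and Y: "Y \<in> mat_algebra k P"
    and eq: "\<And>c. c < k \<Longrightarrow> (\<Sum>r<k. x r * X $$ (r, c)) = (\<Sum>r<k. x r * Y $$ (r, c))"
    and x: "\<exists>r<k. x r \<noteq> 0"
  shows "X = Y"
proof -
  define p where "p = (\<Sum>r<k. monom (x r) r)"
  have coeff_p: "coeff p r = x r" if "r < k" for r using that by (simp add: p_def coeff_sum)
  have "degree p \<le> k - 1"
    unfolding p_def by (intro degree_sum_le) (auto intro: order_trans[OF degree_monom_le])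
  hence "degree p < k" using kpos by simp
  moreover have "p \<noteq> 0" using x coeff_p by force
  ultimately have "\<not> f dvd p" using dvd_imp_degree_le[of f p] deg by auto
  obtain g h where gh: "X = poly_eval_mat k P g" "Y = poly_eval_mat k P h"
    using X Y by (auto simp: mat_algebra_def)
  \<comment> \<open>The row vector \<open>x\<close> times \<open>u(P)\<close> is
    \<open>p * u\<close> modulo \<open>f\<close>. The induction runs over truncations of the sum
    defining \<open>p\<close>.\<close>
  have combination: "(\<Sum>r<k. x r * poly_eval_mat k P u $$ (r, c)) = coeff ((p * u) mod f) c"
    if "c < k" for u c
  proof -
    have "coeff (((\<Sum>r<l. monom (x r) r) * u) mod f) c
        = (\<Sum>r<l. x r * coeff ((monom 1 r * u) mod f) c)" for l
    proof (induction l)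
      case (Suc l)
      have "monom (x l) l * u = Polynomial.smult (x l) (monom 1 l * u)"
        by (simp flip: mult_smult_left add: smult_monom)
      thus ?case using Suc by (simp add: distrib_right poly_mod_add_left mod_smult_left)
    qed simp
    thus ?thesis using that by (simp add: poly_eval_mat_entry p_def)
  qed
  have "(p * g) mod f = (p * h) mod f"
    by (rule poly_mod_eqI) (use eq in \<open>simp add: gh combination\<close>)
  hence "f dvd p * (g - h)"
    by (simp add: mod_eq_dvd_iff right_diff_distrib)
  \<comment> \<open>An irreducible polynomial over a field is prime, and \<open>p\<close> is nonzero
    of smaller degree than \<open>f\<close>, so the factor \<open>p\<close> cancels.\<close>
  hence "f dvd g - h"
    using field_poly_irreducible_imp_prime[OF irred] \<open>\<not> f dvd p\<close> by (auto simp: prime_elem_dvd_mult_iff)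
  thus ?thesis by (simp add: gh poly_eval_mat_eq_iff mod_eq_dvd_iff)
qed

end

subsection \<open>The spread property and the row channel\<close>

lemma dim_block_row [simp]:
  "dim_row (block_row m k B) = k" "dim_col (block_row m k B) = m * k"
  by (simp_all add: block_row_def)

lemma block_index_less:
  fixes j c :: nat
  assumes "j < m" "c < k" shows "j * k + c < m * k"
proof -
  have "j * k + c < Suc j * k" using assms by simp
  also have "\<dots> \<le> m * k" using assms by (intro mult_le_mono1) simp
  finally show ?thesis .
qed

lemma block_block_row:
  assumes "j < m" "B j \<in> carrier_mat k k"
  shows "block k (block_row m k B) j = B j"
  using assms by (intro eq_matI) (auto simp: block_def block_row_def block_index_less)

lemma block_row_cong:
  assumes "\<And>j. j < m \<Longrightarrow> B j = B' j"
  shows "block_row m k B = block_row m k B'"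
  using assms by (intro eq_matI) (auto simp: block_row_def less_mult_imp_div_less)

text \<open>Writing the coefficients as a function \<open>x\<close> allows blockwise comparison of
  vectors without carrier conditions.\<close>

lemma mem_mat_row_space_block_row:
  fixes B :: "nat \<Rightarrow> 'a::field mat"
  shows "v \<in> mat_row_space (block_row m k B) \<longleftrightarrow>
    (\<exists>x. v = vec (m * k) (\<lambda>c. \<Sum>r<k. x r * B (c div k) $$ (r, c mod k)))"
proof -
  let ?M = "block_row m k B"
  have M: "?M \<in> carrier_mat k (m * k)" by (simp add: block_row_def)
  have prod: "?M\<^sup>T *\<^sub>v y = vec (m * k) (\<lambda>c. \<Sum>r<k. y $ r * B (c div k) $$ (r, c mod k))"
    if "y \<in> carrier_vec k" for y
    using that by (intro eq_vecI)
      (auto simp: scalar_prod_def block_row_def lessThan_atLeast0 mult.commute intro!: sum.cong)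
  show ?thesis
  proof
    assume "v \<in> mat_row_space ?M"
    then obtain y where "y \<in> carrier_vec k" "?M\<^sup>T *\<^sub>v y = v"
      unfolding mat_row_space_def dim_block_row vec_space.row_space_eq[OF M] by auto
    thus "\<exists>x. v = vec (m * k) (\<lambda>c. \<Sum>r<k. x r * B (c div k) $$ (r, c mod k))"
      using prod by blast
  next
    assume "\<exists>x. v = vec (m * k) (\<lambda>c. \<Sum>r<k. x r * B (c div k) $$ (r, c mod k))"
    then obtain x where v: "v = vec (m * k) (\<lambda>c. \<Sum>r<k. x r * B (c div k) $$ (r, c mod k))"
      by blast
    hence "?M\<^sup>T *\<^sub>v vec k x = v" by (subst prod) (auto intro!: eq_vecI)
    moreover have "v \<in> carrier_vec (m * k)" by (simp add: v)
    ultimately show "v \<in> mat_row_space ?M"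
      unfolding mat_row_space_def dim_block_row vec_space.row_space_eq[OF M]
      by (auto intro!: bexI[of _ "vec k x"])
  qed
qed

lemma row_in_mat_row_space:
  fixes B :: "nat \<Rightarrow> 'a::field mat"
  assumes "r < k"
  shows "row (block_row m k B) r \<in> mat_row_space (block_row m k B)"
  unfolding mem_mat_row_space_block_row
proof
  show "row (block_row m k B) r =
      vec (m * k) (\<lambda>c. \<Sum>i<k. (if i = r then 1 else 0) * B (c div k) $$ (i, c mod k))"
  proof (rule eq_vecI)
    fix c assume "c < dim_vec (vec (m * k)
        (\<lambda>c. \<Sum>i<k. (if i = r then 1 else 0) * B (c div k) $$ (i, c mod k)))"
    moreover have "(\<Sum>i<k. (if i = r then 1 else 0) * B (c div k) $$ (i, c mod k))
        = (\<Sum>i<k. if i = r then B (c div k) $$ (i, c mod k) else 0)"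
      by (intro sum.cong) auto
    ultimately show "row (block_row m k B) r $ c = vec (m * k)
        (\<lambda>c. \<Sum>i<k. (if i = r then 1 else 0) * B (c div k) $$ (i, c mod k)) $ c"
      using assms by (simp add: sum.delta) (simp add: block_row_def)
  qed simp
qed

text \<open>Exposes the leading position \<open>i\<close>, which \<open>spread_matrices\<close>
  hides under an existential quantifier, so that two matrices can be compared by it.\<close>

definition spread_blocks :: "nat \<Rightarrow> nat \<Rightarrow> 'a::field mat \<Rightarrow> nat \<Rightarrow> (nat \<Rightarrow> 'a mat) \<Rightarrow> bool" where
  "spread_blocks m k P i B \<longleftrightarrow> i < m \<and> (\<forall>j<i. B j = 0\<^sub>m k k) \<and> B i = 1\<^sub>m k \<and>
     (\<forall>j. i < j \<and> j < m \<longrightarrow> B j \<in> mat_algebra k P)"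

lemma spread_matrices_blocks:
  "spread_matrices m k P = {block_row m k B | B i. spread_blocks m k P i B}"
  by (simp add: spread_matrices_def spread_blocks_def)

lemma spread_blocks_carrier:
  assumes "spread_blocks m k P i B" "j < m"
  shows "B j \<in> carrier_mat k k"
  using assms by (cases j i rule: linorder_cases)
    (auto simp: spread_blocks_def mat_algebra_def poly_eval_mat_def)

lemma spread_blocks_row_nonzero:
  fixes P :: "'a::field mat"
  assumes "spread_blocks m k P i B" "r < k"
  shows "row (block_row m k B) r \<noteq> 0\<^sub>v (m * k)"
proof
  assume "row (block_row m k B) r = 0\<^sub>v (m * k)"
  \<comment> \<open>This entry is the diagonal 1 in row \<open>r\<close> of the leading identity
    block.\<close>
  hence "row (block_row m k B) r $ (i * k + r) = 0\<^sub>v (m * k) $ (i * k + r)" by simp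
  thus False using assms by (simp add: block_row_def spread_blocks_def block_index_less)
qed

context
  fixes f :: "'a::{field,finite} poly" and P :: "'a mat" and k :: nat
  assumes monic: "lead_coeff f = 1" and kpos: "0 < k" and deg: "degree f = k"
    and P: "P = companion_mat f" and irred: "irreducible f"
begin

text \<open>The first nonzero block of a common vector sits at the leading position of both matrices
  and equals the coefficient vector. Position and coefficients therefore agree, and cancelling the
  nonzero coefficient vector identifies the later blocks.\<close>

lemma spread_trivial_intersection:
  assumes M: "M \<in> spread_matrices m k P" and M': "M' \<in> spread_matrices m k P"
    and v: "v \<in> mat_row_space M" "v \<in> mat_row_space M'" "v \<noteq> 0\<^sub>v (m * k)"
  shows "M = M'"
proof -
  obtain B i where B: "M = block_row m k B" "spread_blocks m k P i B"
    using M by (auto simp: spread_matrices_blocks)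
  obtain B' i' where B': "M' = block_row m k B'" "spread_blocks m k P i' B'"
    using M' by (auto simp: spread_matrices_blocks)
  obtain x where x: "v = vec (m * k) (\<lambda>c. \<Sum>r<k. x r * B (c div k) $$ (r, c mod k))"
    using v(1) B(1) by (auto simp: mem_mat_row_space_block_row)
  obtain y where y: "v = vec (m * k) (\<lambda>c. \<Sum>r<k. y r * B' (c div k) $$ (r, c mod k))"
    using v(2) B'(1) by (auto simp: mem_mat_row_space_block_row)
  have v_entry: "v $ (j * k + c) = (\<Sum>r<k. z r * D j $$ (r, c))"
    if "v = vec (m * k) (\<lambda>c. \<Sum>r<k. z r * D (c div k) $$ (r, c mod k))" "j < m" "c < k"
    for z D j c
    using that by (simp add: block_index_less)
  have lead: "v $ (j * k + c) = z c"
    if "v = vec (m * k) (\<lambda>c. \<Sum>r<k. z r * D (c div k) $$ (r, c mod k))"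
      "spread_blocks m k P j D" "c < k" for z D j c
  proof -
    have "j < m" "D j = 1\<^sub>m k" using that(2) by (auto simp: spread_blocks_def)
    hence "v $ (j * k + c) = (\<Sum>r<k. if r = c then z r else 0)"
      using that(3) unfolding v_entry[OF that(1) \<open>j < m\<close> that(3)] by (intro sum.cong) auto
    thus ?thesis using that(3) by simp
  qed
  have before: "v $ (j * k + c) = 0"
    if "v = vec (m * k) (\<lambda>c. \<Sum>r<k. z r * D (c div k) $$ (r, c mod k))"
      "spread_blocks m k P i D" "c < k" "j < i" for z D i j c
  proof -
    have "j < m" "D j = 0\<^sub>m k k" using that(2,4) by (auto simp: spread_blocks_def)
    thus ?thesis using v_entry[OF that(1) \<open>j < m\<close> that(3)] that(3) by simp
  qed
  have nz: "\<exists>r<k. z r \<noteq> 0"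
    if "v = vec (m * k) (\<lambda>c. \<Sum>r<k. z r * D (c div k) $$ (r, c mod k))" for z D
  proof (rule ccontr)
    assume "\<not> (\<exists>r<k. z r \<noteq> 0)"
    hence "v = 0\<^sub>v (m * k)" using that by (intro eq_vecI) auto
    thus False using v(3) by simp
  qed
  \<comment> \<open>If \<open>i < i'\<close>, block \<open>i\<close> of \<open>v\<close> is
    \<open>x\<close> by the first representation and zero by the second, contradicting that
    \<open>x\<close> is nonzero; the other case is symmetric.\<close>
  have "i = i'"
  proof (rule linorder_cases[of i i'])
    assume "i < i'"
    hence "x r = 0" if "r < k" for r using lead[OF x B(2) that] before[OF y B'(2) that] by simp
    thus ?thesis using nz[OF x] by auto
  next
    assume "i' < i"
    hence "y r = 0" if "r < k" for r using lead[OF y B'(2) that] before[OF x B(2) that] by simp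
    thus ?thesis using nz[OF y] by auto
  qed
  have "x r = y r" if "r < k" for r
    using lead[OF x B(2) that] lead[OF y B'(2) that] \<open>i = i'\<close> by simp
  have "B j = B' j" if "j < m" for j
  proof (cases "i < j")
    case True
    show ?thesis
    proof (rule mat_algebra_left_cancel[OF monic kpos deg P irred])
      show "B j \<in> mat_algebra k P" "B' j \<in> mat_algebra k P"
        using B(2) B'(2) True that \<open>i = i'\<close> by (auto simp: spread_blocks_def)
      show "(\<Sum>r<k. x r * B j $$ (r, c)) = (\<Sum>r<k. x r * B' j $$ (r, c))" if "c < k" for c
        using v_entry[OF x \<open>j < m\<close> that] v_entry[OF y \<open>j < m\<close> that] \<open>\<And>r. r < k \<Longrightarrow> x r = y r\<close> by simp
      show "\<exists>r<k. x r \<noteq> 0" by (rule nz[OF x])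
    qed
  next
    case False
    thus ?thesis using B(2) B'(2) \<open>i = i'\<close> by (cases "j = i") (auto simp: spread_blocks_def)
  qed
  thus ?thesis unfolding B(1) B'(1) by (rule block_row_cong)
qed

lemma spread_row:
  assumes "M \<in> spread_matrices m k P" "r < k"
  shows "row M r \<in> mat_row_space M" "row M r \<noteq> 0\<^sub>v (m * k)"
proof -
  obtain B i where "M = block_row m k B" "spread_blocks m k P i B"
    using assms(1) by (auto simp: spread_matrices_blocks)
  thus "row M r \<in> mat_row_space M" "row M r \<noteq> 0\<^sub>v (m * k)"
    using assms(2) by (simp_all add: row_in_mat_row_space spread_blocks_row_nonzero)
qed

text \<open>Row 0 is a nonzero vector in the row space, so equal row spaces share one. This is what
  makes \<open>sent_matrix\<close> well defined.\<close>

lemma inj_on_mat_row_space: "inj_on mat_row_space (spread_matrices m k P)"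
  using spread_trivial_intersection spread_row[OF _ kpos] by (intro inj_onI) metis

lemma sent_matrix_mat_row_space:
  assumes "M \<in> spread_matrices m k P"
  shows "sent_matrix m k P (mat_row_space M) = M"
  unfolding sent_matrix_def
  using assms inj_on_mat_row_space[of m] by (intro the_equality) (auto dest: inj_onD)

lemma spread_matrices_dim:
  "M \<in> spread_matrices m k P \<Longrightarrow> dim_row M = k \<and> dim_col M = m * k"
  by (auto simp: spread_matrices_blocks)

lemma spread_matrices_nonempty:
  assumes "0 < m"
  shows "spread_matrices m k P \<noteq> {}"
proof -
  have "spread_blocks m k P 0 (\<lambda>j. if j = 0 then 1\<^sub>m k else 0\<^sub>m k k)"
    using assms zero_mat_in_algebra[OF monic kpos deg P] by (simp add: spread_blocks_def)
  thus ?thesis unfolding spread_matrices_blocks by blast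
qed

text \<open>If every row is affected, nothing arrives. Conversely, an intact row is a nonzero vector
  and lies in only one codeword.\<close>

lemma row_correctable_iff:
  assumes "0 < m" "E \<in> erasure_patterns k (m * k)"
  shows "row_correctable m k P E \<longleftrightarrow> \<not> {..<k} \<subseteq> fst ` E"
proof
  assume corr: "row_correctable m k P E"
  \<comment> \<open>Some codeword must exist, as correctability quantifies universally over the
    code.\<close>
  obtain M where M: "M \<in> spread_matrices m k P"
    using spread_matrices_nonempty[OF assms(1)] by auto
  have "received_rows E M \<noteq> {}"
  proof -
    have "mat_row_space M \<in> spread_code m k P" using M by (simp add: spread_code_def)
    thus ?thesis using corr sent_matrix_mat_row_space[OF M] unfolding row_correctable_def by metis
  qed
  then obtain r where "r < dim_row M" "\<forall>j<dim_col M. (r, j) \<notin> E"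
    unfolding received_rows_def by blast
  hence "r < k" "\<forall>j<m * k. (r, j) \<notin> E" using spread_matrices_dim[OF M] by auto
  thus "\<not> {..<k} \<subseteq> fst ` E" using assms(2) by (force simp: erasure_patterns_def)
next
  assume "\<not> {..<k} \<subseteq> fst ` E"
  then obtain r where r: "r < k" "\<And>j. (r, j) \<notin> E" by force
  have rec: "row M r \<in> received_rows E M" if "M \<in> spread_matrices m k P" for M
    using spread_matrices_dim[OF that] r by (auto simp: received_rows_def)
  have "received_rows E (sent_matrix m k P (mat_row_space M)) \<noteq> {} \<and>
      (\<forall>V\<in>spread_code m k P.
        received_rows E (sent_matrix m k P (mat_row_space M)) \<subseteq> V \<longrightarrow> V = mat_row_space M)"
    if M: "M \<in> spread_matrices m k P" for M
    unfolding sent_matrix_mat_row_space[OF M]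
  proof (intro conjI ballI impI)
    show "received_rows E M \<noteq> {}" using rec[OF M] by blast
    fix V assume "V \<in> spread_code m k P" "received_rows E M \<subseteq> V"
    then obtain M' where "V = mat_row_space M'" "M' \<in> spread_matrices m k P" "row M r \<in> V"
      using rec[OF M] by (auto simp: spread_code_def)
    thus "V = mat_row_space M"
      using spread_trivial_intersection[OF M] spread_row[OF M r(1)] by metis
  qed
  thus "row_correctable m k P E" unfolding row_correctable_def by (simp add: spread_code_def)
qed

lemma num_row_correctable_eq:
  assumes "0 < m"
  shows "real (num_row_correctable m k P) = 2 ^ (k * (m * k)) - (2 ^ (m * k) - 1) ^ k"
proof -
  let ?G = "{..<k} \<times> {..<m * k}"
  have "{E \<in> erasure_patterns k (m * k). row_correctable m k P E}
      = Pow ?G - {E. E \<subseteq> ?G \<and> {..<k} \<subseteq> fst ` E}"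
    using row_correctable_iff[OF assms] by (auto simp: erasure_patterns_def)
  moreover have "real (card (Pow ?G - {E. E \<subseteq> ?G \<and> {..<k} \<subseteq> fst ` E}))
      = real (card (Pow ?G)) - real (card {E. E \<subseteq> ?G \<and> {..<k} \<subseteq> fst ` E})"
    by (rule real_card_Diff_subset) auto
  ultimately show ?thesis
    by (simp add: num_row_correctable_def card_Pow card_cartesian_product card_full_rows of_nat_diff)
qed

end

subsection \<open>The column channel\<close>

abbreviation block_cells :: "nat \<Rightarrow> nat \<Rightarrow> (nat \<times> nat) set" where
  "block_cells k j \<equiv> {..<k} \<times> {j * k..<j * k + k}"

text \<open>These patterns leave some column of block \<open>j\<close> intact; their number is the
  \<open>N\<close> of the theorem, whatever \<open>j\<close> is.\<close>

definition partial_erasures :: "nat \<Rightarrow> nat \<Rightarrow> (nat \<times> nat) set set" where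
  "partial_erasures k j = Pow (block_cells k j) - full_columns {..<k} {j * k..<j * k + k}"

lemma mem_block_iff:
  fixes c j k :: nat
  assumes "0 < k"
  shows "c \<in> {j * k..<j * k + k} \<longleftrightarrow> c div k = j"
proof
  assume "c \<in> {j * k..<j * k + k}"
  thus "c div k = j" by (intro div_nat_eqI) (auto simp: mult.commute)
next
  assume "c div k = j"
  hence "c = j * k + c mod k" using div_mult_mod_eq[of c k] by simp
  moreover have "c mod k < k" using assms by simp
  ultimately show "c \<in> {j * k..<j * k + k}" by simp
qed

lemma erasure_grid_blocks:
  assumes "0 < k"
  shows "{..<k} \<times> {..<m * k} = (\<Union>j<m. block_cells k j)"
proof -
  have "c < m * k \<longleftrightarrow> (\<exists>j<m. c \<in> {j * k..<j * k + k})" for c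
    using assms by (simp only: mem_block_iff) (simp add: div_less_iff_less_mult)
  thus ?thesis by auto
qed

lemma disjoint_block_cells:
  assumes "0 < k"
  shows "disjoint_family_on (block_cells k) {..<m}"
proof -
  have "c \<in> {i * k..<i * k + k} \<Longrightarrow> c \<in> {j * k..<j * k + k} \<Longrightarrow> i = j" for c i j
    using assms by (simp only: mem_block_iff)
  thus ?thesis by (fastforce simp: disjoint_family_on_def)
qed

lemma card_partial_erasures:
  "real (card (partial_erasures k j)) = 2 ^ (k\<^sup>2) - (2 ^ k - 1) ^ k"
proof -
  have "real (card (partial_erasures k j)) = real (card (Pow (block_cells k j)))
      - real (card (full_columns {..<k} {j * k..<j * k + k}))"
    unfolding partial_erasures_def
    by (rule real_card_Diff_subset) (auto simp: full_columns_def)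
  thus ?thesis
    by (simp add: card_Pow card_cartesian_product card_full_columns of_nat_diff power2_eq_square)
qed

lemma empty_partial_erasure:
  assumes "0 < k"
  shows "{} \<in> partial_erasures k j"
  using assms by (auto simp: partial_erasures_def full_columns_def)

context
  fixes E :: "(nat \<times> nat) set" and k m j :: nat
  assumes E: "E \<subseteq> {..<k} \<times> {..<m * k}" and k: "0 < k"
begin

lemma affected_columns_eq: "affected_columns k E j = snd ` (E \<inter> block_cells k j)"
  using E unfolding affected_columns_def mem_block_iff[OF k, symmetric] by force

lemma affected_columns_empty_iff: "affected_columns k E j = {} \<longleftrightarrow> E \<inter> block_cells k j = {}"
  by (simp add: affected_columns_eq)

text \<open>A block has exactly \<open>k\<close> columns, so at most \<open>k - 1\<close> are
  affected precisely when one is missed.\<close>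

lemma card_affected_columns_iff:
  "card (affected_columns k E j) \<le> k - 1 \<longleftrightarrow> E \<inter> block_cells k j \<in> partial_erasures k j"
proof -
  let ?I = "{j * k..<j * k + k}" and ?A = "affected_columns k E j"
  have sub: "?A \<subseteq> ?I" by (auto simp: affected_columns_eq)
  hence "card ?A \<le> card ?I" by (intro card_mono) auto
  moreover have "card ?A = card ?I \<longleftrightarrow> ?I \<subseteq> ?A"
    by (metis card_subset_eq finite_atLeastLessThan order_refl sub subset_antisym)
  ultimately have "card ?A \<le> k - 1 \<longleftrightarrow> \<not> ?I \<subseteq> ?A"
    using k by (simp del: ivl_subset) linarith
  thus ?thesis by (auto simp: affected_columns_eq partial_erasures_def full_columns_def)
qed

end

text \<open>The subtracted product counts the patterns that hit every nonzero block without erasing any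
  block completely.\<close>

lemma card_column_patterns:
  fixes N :: real
  assumes "0 < k" "N = 2 ^ (k\<^sup>2) - (2 ^ k - 1) ^ k"
  shows "real (card {E \<in> erasure_patterns k (m * k).
      (\<exists>j<m. B j \<noteq> 0\<^sub>m k k \<and> affected_columns k E j = {}) \<and>
      (\<forall>j<m. card (affected_columns k E j) \<le> k - 1)})
    = N ^ m - (\<Prod>j<m. if B j = 0\<^sub>m k k then N else N - 1)"
proof -
  \<comment> \<open>\<open>?D j\<close> lists the traces on block \<open>j\<close> allowed in the
    subtracted patterns: on a nonzero block the empty trace is removed, taking the count from
    \<open>N\<close> to \<open>N - 1\<close>.\<close>
  let ?D = "\<lambda>j. if B j = 0\<^sub>m k k then partial_erasures k j else partial_erasures k j - {{}}"
  let ?S = "\<lambda>D. {E. E \<subseteq> (\<Union>j<m. block_cells k j) \<and> (\<forall>j\<in>{..<m}. E \<inter> block_cells k j \<in> D j)}"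
  have fin: "finite (partial_erasures k j)" for j by (simp add: partial_erasures_def)
  have card: "card (?S D) = (\<Prod>j<m. card (D j))" if "\<And>j. D j \<subseteq> partial_erasures k j" for D
    by (rule card_local_subsets) (use that assms disjoint_block_cells in \<open>auto simp: partial_erasures_def\<close>)
  have "card (?D j) = (if B j = 0\<^sub>m k k then card (partial_erasures k j) else card (partial_erasures k j) - 1)" for j
    using empty_partial_erasure[OF assms(1)] by simp
  moreover have "0 < card (partial_erasures k j)" for j
    using empty_partial_erasure[OF assms(1), of j] fin[of j] by (auto simp: card_gt_0_iff)
  ultimately have D: "real (card (?D j)) = (if B j = 0\<^sub>m k k then N else N - 1)" for j
    using card_partial_erasures[of k j] assms(2) by (simp add: of_nat_diff Suc_leI)
  have "{E \<in> erasure_patterns k (m * k).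
      (\<exists>j<m. B j \<noteq> 0\<^sub>m k k \<and> affected_columns k E j = {}) \<and>
      (\<forall>j<m. card (affected_columns k E j) \<le> k - 1)} = ?S (partial_erasures k) - ?S ?D"
    (is "?L = _")
  proof (rule Set.set_eqI)
    fix E
    show "E \<in> ?L \<longleftrightarrow> E \<in> ?S (partial_erasures k) - ?S ?D"
    proof (cases "E \<subseteq> {..<k} \<times> {..<m * k}")
      case True
      have all: "E \<in> ?S (partial_erasures k) \<longleftrightarrow> (\<forall>j<m. E \<inter> block_cells k j \<in> partial_erasures k j)"
        using True erasure_grid_blocks[OF assms(1), of m] by (simp add: Ball_def)
      have unhit: "E \<in> ?S ?D \<longleftrightarrow> (\<forall>j<m. E \<inter> block_cells k j \<in> ?D j)"
        using True erasure_grid_blocks[OF assms(1), of m] by (simp add: Ball_def)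
      have corr: "E \<in> ?L \<longleftrightarrow> (\<exists>j<m. B j \<noteq> 0\<^sub>m k k \<and> E \<inter> block_cells k j = {}) \<and>
          (\<forall>j<m. E \<inter> block_cells k j \<in> partial_erasures k j)"
        using True affected_columns_empty_iff[OF True assms(1)]
          card_affected_columns_iff[OF True assms(1)]
        by (simp add: erasure_patterns_def)
      show ?thesis unfolding Diff_iff all unhit corr by (auto split: if_splits)
    next
      case False
      thus ?thesis using erasure_grid_blocks[OF assms(1), of m] by (simp add: erasure_patterns_def)
    qed
  qed
  moreover have "real (card (?S (partial_erasures k) - ?S ?D))
      = real (card (?S (partial_erasures k))) - real (card (?S ?D))"
  proof (rule real_card_Diff_subset)
    have "finite (Pow (\<Union>j<m. block_cells k j))" by blast
    thus "finite (?S (partial_erasures k))" by (rule rev_finite_subset) blast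
    show "?S ?D \<subseteq> ?S (partial_erasures k)" by (auto split: if_splits)
  qed
  moreover have "card (?S ?D) = (\<Prod>j<m. card (?D j))" by (rule card[of ?D]) simp
  hence "real (card (?S ?D)) = (\<Prod>j<m. if B j = 0\<^sub>m k k then N else N - 1)"
    by (simp only: of_nat_prod D)
  moreover have "card (?S (partial_erasures k)) = (\<Prod>j<m. card (partial_erasures k j))"
    by (rule card[of "partial_erasures k"]) simp
  hence "real (card (?S (partial_erasures k))) = N ^ m"
    by (simp only: of_nat_prod card_partial_erasures assms(2) prod_constant card_lessThan)
  ultimately show ?thesis by (simp only:)
qed

section \<open>Parametrization of the spread code\<close>

definition leading_blocks :: "nat \<Rightarrow> nat \<Rightarrow> (nat \<Rightarrow> 'a::field mat) \<Rightarrow> nat \<Rightarrow> 'a mat" where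
  "leading_blocks k i X j = (if j < i then 0\<^sub>m k k else if j = i then 1\<^sub>m k else X j)"

text \<open>The functions are extensional, so that each generator matrix has exactly one
  index.\<close>

definition spread_index :: "nat \<Rightarrow> nat \<Rightarrow> 'a::field mat \<Rightarrow> (nat \<times> (nat \<Rightarrow> 'a mat)) set" where
  "spread_index m k P = (SIGMA i:{..<m}. {i<..<m} \<rightarrow>\<^sub>E mat_algebra k P)"

lemma zero_mat_neq_one_mat: "0 < k \<Longrightarrow> 0\<^sub>m k k \<noteq> (1\<^sub>m k :: 'a::field mat)"
  by (metis index_one_mat(1) index_zero_mat(1) zero_neq_one)

lemma spread_blocks_leading:
  "(i, X) \<in> spread_index m k P \<Longrightarrow> spread_blocks m k P i (leading_blocks k i X)"
  by (auto simp: spread_index_def spread_blocks_def leading_blocks_def PiE_iff)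

text \<open>The blocks can be read back from the block row, and the leading position is that of the
  first nonzero block.\<close>

lemma bij_betw_spread_index:
  assumes "0 < k"
  shows "bij_betw (\<lambda>(i, X). block_row m k (leading_blocks k i X)) (spread_index m k P) (spread_matrices m k P)"
    (is "bij_betw ?F _ _")
proof (rule bij_betw_imageI)
  show "inj_on ?F (spread_index m k P)"
  proof (rule inj_onI; clarify)
    fix i X i' X'
    assume idx: "(i, X) \<in> spread_index m k P" "(i', X') \<in> spread_index m k P"
      and eq: "block_row m k (leading_blocks k i X) = block_row m k (leading_blocks k i' X')"
    have bl: "leading_blocks k i X j = leading_blocks k i' X' j" if "j < m" for j
      using arg_cong[OF eq, of "\<lambda>M. block k M j"] that
        spread_blocks_carrier[OF spread_blocks_leading[OF idx(1)] that]
        spread_blocks_carrier[OF spread_blocks_leading[OF idx(2)] that]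
      by (simp add: block_block_row)
    have im: "i < m" "i' < m" using idx by (auto simp: spread_index_def)
    \<comment> \<open>Were the positions different, at the smaller one a zero block would equal an
      identity block.\<close>
    hence "i = i'"
      using bl[OF im(1)] bl[OF im(2)] zero_mat_neq_one_mat[OF assms, where 'a = 'a]
      by (cases i i' rule: linorder_cases) (auto simp: leading_blocks_def)
    moreover have "X = X'"
    proof
      fix j
      show "X j = X' j"
      proof (cases "j \<in> {i<..<m}")
        case True
        thus ?thesis using bl[of j] \<open>i = i'\<close> by (simp add: leading_blocks_def)
      next
        case False
        thus ?thesis using idx \<open>i = i'\<close>
          by (auto simp: spread_index_def PiE_def extensional_def)
      qed
    qed
    ultimately show "i = i' \<and> X = X'" by simp
  qed
  show "?F ` spread_index m k P = spread_matrices m k P"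
  proof
    show "?F ` spread_index m k P \<subseteq> spread_matrices m k P"
    proof (rule image_subsetI, clarify)
      fix i X assume "(i, X) \<in> spread_index m k P"
      thus "block_row m k (leading_blocks k i X) \<in> spread_matrices m k P"
        unfolding spread_matrices_blocks using spread_blocks_leading by blast
    qed
    show "spread_matrices m k P \<subseteq> ?F ` spread_index m k P"
    proof
      fix M assume "M \<in> spread_matrices m k P"
      then obtain B i where B: "M = block_row m k B" "spread_blocks m k P i B"
        by (auto simp: spread_matrices_blocks)
      show "M \<in> ?F ` spread_index m k P"
      proof (rule image_eqI)
        show "(i, restrict B {i<..<m}) \<in> spread_index m k P"
          using B(2) by (auto simp: spread_index_def spread_blocks_def)
        show "M = ?F (i, restrict B {i<..<m})"
          unfolding B(1) prod.case
          by (rule block_row_cong) (use B(2) in \<open>auto simp: leading_blocks_def spread_blocks_def\<close>)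
      qed
    qed
  qed
qed

text \<open>The blocks up to \<open>i\<close> are fixed, and the \<open>m - Suc i\<close> later ones
  range independently over the algebra, so the sum of products is a product of sums.\<close>

lemma sum_prod_leading_blocks:
  fixes w :: "'a::{field,finite} mat \<Rightarrow> real"
  assumes "i < m" "finite (mat_algebra k P)"
  shows "(\<Sum>X\<in>{i<..<m} \<rightarrow>\<^sub>E mat_algebra k P. \<Prod>j<m. w (leading_blocks k i X j))
    = w (0\<^sub>m k k) ^ i * w (1\<^sub>m k) * (\<Sum>Y\<in>mat_algebra k P. w Y) ^ (m - Suc i)"
proof -
  have "(\<Prod>j<m. w (leading_blocks k i X j))
      = w (0\<^sub>m k k) ^ i * w (1\<^sub>m k) * (\<Prod>j\<in>{i<..<m}. w (X j))" for X
  proof -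
    have split: "{..<m} = {..<i} \<union> insert i {i<..<m}" using assms by auto
    have "(\<Prod>j<m. w (leading_blocks k i X j)) = (\<Prod>j<i. w (leading_blocks k i X j))
        * (\<Prod>j\<in>insert i {i<..<m}. w (leading_blocks k i X j))"
      unfolding split by (rule prod.union_disjoint) auto
    thus ?thesis by (simp add: leading_blocks_def)
  qed
  moreover have "(\<Sum>X\<in>{i<..<m} \<rightarrow>\<^sub>E mat_algebra k P. \<Prod>j\<in>{i<..<m}. w (X j))
      = (\<Sum>Y\<in>mat_algebra k P. w Y) ^ (m - Suc i)"
    using assms(2) by (subst prod_sum_PiE[symmetric]) auto
  ultimately show ?thesis by (simp flip: sum_distrib_left)
qed

section \<open>Averaging over the spread code\<close>

context
  fixes f :: "'a::{field,finite} poly" and P :: "'a mat" and k :: nat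
  assumes monic: "lead_coeff f = 1" and kpos: "0 < k" and deg: "degree f = k"
    and P: "P = companion_mat f" and irred: "irreducible f"
begin

lemma finite_mat_algebra: "finite (mat_algebra k P)"
  using card_mat_algebra[OF monic kpos deg P] by (auto intro: card_ge_0_finite)

text \<open>Grouping by leading position turns the code size and the total count into geometric
  sums; multiplication by \<open>Q - 1\<close> makes them differences of powers.\<close>

lemma avg_column_correctable_eq:
  fixes N :: real
  assumes m: "0 < m" and N: "N = 2 ^ (k\<^sup>2) - (2 ^ k - 1) ^ k" "1 \<le> N"
  defines "Q \<equiv> real CARD('a) ^ k"
  assumes Q: "1 < Q"
  shows "avg_column_correctable m k P
    = N ^ m / (Q ^ m - 1) * (Q ^ m - ((Q - 1) * (N - 1) / N + 1) ^ m)"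
proof -
  let ?F = "mat_algebra k P" and ?w = "\<lambda>Y :: 'a mat. if Y = 0\<^sub>m k k then N else N - 1"
  \<comment> \<open>The total weight of one free block: \<open>N\<close> for the zero matrix and
    \<open>N - 1\<close> for each of the other \<open>Q - 1\<close> matrices.\<close>
  define S where "S = N + (Q - 1) * (N - 1)"
  have card_F: "real (card ?F) = Q"
    using card_mat_algebra[OF monic kpos deg P] by (simp add: Q_def)
  have "(\<Sum>Y\<in>?F. ?w Y) = ?w (0\<^sub>m k k) + (\<Sum>Y\<in>?F - {0\<^sub>m k k}. ?w Y)"
    by (rule sum.remove) (use finite_mat_algebra zero_mat_in_algebra[OF monic kpos deg P] in auto)
  also have "(\<Sum>Y\<in>?F - {0\<^sub>m k k}. ?w Y) = (\<Sum>Y\<in>?F - {0\<^sub>m k k}. N - 1)"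
    by (intro sum.cong) auto
  also have "\<dots> = (real (card ?F) - 1) * (N - 1)"
    using real_card_Diff_subset[OF finite_mat_algebra, of "{0\<^sub>m k k}"]
      zero_mat_in_algebra[OF monic kpos deg P] by simp
  finally have sum_w: "(\<Sum>Y\<in>?F. ?w Y) = S" by (simp add: S_def card_F)
  have over_code: "(\<Sum>U\<in>spread_code m k P. g U) = (\<Sum>i<m. \<Sum>X\<in>{i<..<m} \<rightarrow>\<^sub>E ?F.
      g (mat_row_space (block_row m k (leading_blocks k i X))))" for g :: "'a vec set \<Rightarrow> real"
  proof -
    have "(\<Sum>U\<in>spread_code m k P. g U) = (\<Sum>M\<in>spread_matrices m k P. g (mat_row_space M))"
      using inj_on_mat_row_space[OF monic kpos deg P irred]
      by (simp add: spread_code_def sum.reindex)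
    also have "\<dots> = (\<Sum>(i, X)\<in>spread_index m k P. g (mat_row_space (block_row m k (leading_blocks k i X))))"
      using sum.reindex_bij_betw[OF bij_betw_spread_index[OF kpos], of "\<lambda>M. g (mat_row_space M)" m P]
      by (simp add: case_prod_beta')
    finally show ?thesis
      using finite_mat_algebra
      by (simp add: spread_index_def sum.Sigma finite_PiE)
  qed
  have "real (card (spread_code m k P)) = (\<Sum>i<m. Q ^ (m - Suc i))"
    using over_code[of "\<lambda>_. 1"] by (simp add: card_PiE card_F)
  hence card_code: "(Q - 1) * real (card (spread_code m k P)) = Q ^ m - 1"
    using power_diff_sumr2[of 1 m Q] by (simp add: algebra_simps)
  have correctable: "real (card {E \<in> erasure_patterns k (m * k).
      column_correctable m k P (mat_row_space (block_row m k (leading_blocks k i X))) E})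
    = N ^ m - (\<Prod>j<m. ?w (leading_blocks k i X j))"
    if "i < m" "X \<in> {i<..<m} \<rightarrow>\<^sub>E ?F" for i X
  proof -
    have bl: "spread_blocks m k P i (leading_blocks k i X)"
      using that by (intro spread_blocks_leading) (simp add: spread_index_def)
    hence "block_row m k (leading_blocks k i X) \<in> spread_matrices m k P"
      by (auto simp: spread_matrices_blocks)
    note sent = sent_matrix_mat_row_space[OF monic kpos deg P irred this]
    have "block k (block_row m k (leading_blocks k i X)) j = leading_blocks k i X j" if "j < m" for j
      by (rule block_block_row[where B = "leading_blocks k i X", OF that spread_blocks_carrier[OF bl that]])
    thus ?thesis
      unfolding card_column_patterns[OF kpos N(1), of m "leading_blocks k i X", symmetric]
        column_correctable_def sent
      by (intro arg_cong[where f = "\<lambda>A. real (card A)"] Collect_cong) auto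
  qed
  define T where "T = (\<Sum>U\<in>spread_code m k P.
      real (card {E \<in> erasure_patterns k (m * k). column_correctable m k P U E}))"
  have "T = (\<Sum>i<m. \<Sum>X\<in>{i<..<m} \<rightarrow>\<^sub>E ?F. N ^ m - (\<Prod>j<m. ?w (leading_blocks k i X j)))"
    unfolding T_def over_code by (intro sum.cong refl correctable) auto
  also have "\<dots> = (\<Sum>i<m. N ^ m * Q ^ (m - Suc i) - N ^ i * (N - 1) * S ^ (m - Suc i))"
  proof (intro sum.cong refl)
    fix i assume "i \<in> {..<m}"
    hence "(\<Sum>X\<in>{i<..<m} \<rightarrow>\<^sub>E ?F. \<Prod>j<m. ?w (leading_blocks k i X j))
        = N ^ i * (N - 1) * S ^ (m - Suc i)"
      using sum_prod_leading_blocks[OF _ finite_mat_algebra, of i m ?w] sum_w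
        zero_mat_neq_one_mat[OF kpos, where 'a = 'a] by auto
    thus "(\<Sum>X\<in>{i<..<m} \<rightarrow>\<^sub>E ?F. N ^ m - (\<Prod>j<m. ?w (leading_blocks k i X j)))
        = N ^ m * Q ^ (m - Suc i) - N ^ i * (N - 1) * S ^ (m - Suc i)"
      by (simp add: sum_subtractf card_PiE card_F)
  qed
  also have "\<dots> = N ^ m * (\<Sum>i<m. Q ^ (m - Suc i)) - (N - 1) * (\<Sum>i<m. S ^ (m - Suc i) * N ^ i)"
    by (simp add: sum_subtractf sum_distrib_left mult_ac)
  \<comment> \<open>The factor \<open>Q - 1\<close> sums the first series, and
    \<open>(Q - 1) * (N - 1) = S - N\<close> sums the second.\<close>
  finally have "(Q - 1) * T = N ^ m * ((Q - 1) * (\<Sum>i<m. Q ^ (m - Suc i)))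
      - (Q - 1) * (N - 1) * (\<Sum>i<m. S ^ (m - Suc i) * N ^ i)"
    by (simp add: right_diff_distrib mult_ac)
  also have "(Q - 1) * (\<Sum>i<m. Q ^ (m - Suc i)) = Q ^ m - 1"
    using power_diff_sumr2[of 1 m Q] by (simp add: algebra_simps)
  also have "(Q - 1) * (N - 1) * (\<Sum>i<m. S ^ (m - Suc i) * N ^ i) = S ^ m - N ^ m"
    using power_diff_sumr2[of N m S] by (simp add: S_def algebra_simps)
  finally have "(Q - 1) * T = N ^ m * Q ^ m - S ^ m" by (simp add: algebra_simps)
  also have "S = N * ((Q - 1) * (N - 1) / N + 1)" using N(2) by (simp add: S_def field_simps)
  finally have "(Q - 1) * T = N ^ m * (Q ^ m - ((Q - 1) * (N - 1) / N + 1) ^ m)"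
    by (simp add: power_mult_distrib right_diff_distrib)
  moreover have "avg_column_correctable m k P
      = ((Q - 1) * T) / ((Q - 1) * real (card (spread_code m k P)))"
    using Q by (simp add: avg_column_correctable_def T_def)
  ultimately show ?thesis by (simp add: card_code)
qed

end

subsection \<open>The ratio\<close>

text \<open>The limit is stated for \<open>2 \<le> k\<close>: at \<open>k = 1\<close> one has
  \<open>N = 1\<close>, and both counts equal 1 for every positive \<open>m\<close>, so the ratio
  stays 1.\<close>

theorem theorem4p10:
  fixes f :: "'a::{field,finite} poly" and P :: "'a mat" and q k :: nat and N :: real
  assumes "q = CARD('a)"
    and "0 < k"
    and "lead_coeff f = 1" and "irreducible f" and "degree f = k"
    and "P = companion_mat f" and "invertible_mat P"
    and "N = 2 ^ (k ^ 2) - (2 ^ k - 1) ^ k"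
  shows "(\<forall>m n. 0 < m \<and> n = m * k \<longrightarrow>
            real (num_row_correctable m k P) = 2 ^ (k * n) - (2 ^ n - 1) ^ k \<and>
            avg_column_correctable m k P =
              N ^ m / (real q ^ n - 1) *
                (real q ^ n - ((real q ^ k - 1) * (N - 1) / N + 1) ^ m) \<and>
            real (num_row_correctable m k P) / avg_column_correctable m k P
              \<le> real k * N * (2 ^ ((k - 1) * k) / N) ^ m) \<and>
         (2 \<le> k \<longrightarrow>
            (\<lambda>m. real (num_row_correctable m k P) / avg_column_correctable m k P)
              \<longlonglongrightarrow> 0)"
proof -
  define Q where "Q = real q ^ k"
  have "card {0, 1 :: 'a} \<le> CARD('a)" by (intro card_mono) auto
  hence "1 < real q" using assms(1) by simp
  hence Q: "1 < Q" using assms(2) by (simp add: Q_def)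
  have N_eq: "N = (2 ^ k) ^ k - (2 ^ k - 1) ^ k"
    using assms(8) by (simp add: power2_eq_square power_mult)
  have small: "2 ^ ((k - 1) * k) < N" if "2 \<le> k"
    using power_diff_gt[OF that, of "2 ^ k"] assms(2) self_le_power[of "2::real" k]
    by (simp add: N_eq mult.commute flip: power_mult)
  have N1: "1 \<le> N"
  proof (cases "2 \<le> k")
    case True
    have "(1::real) \<le> 2 ^ ((k - 1) * k)" by simp
    thus ?thesis using small[OF True] by linarith
  next
    case False
    hence "k = 1" using assms(2) by simp
    thus ?thesis by (simp add: assms(8))
  qed
  note row = num_row_correctable_eq[OF assms(3,2,5,6,4)]
  have avg: "avg_column_correctable m k P
      = N ^ m / (Q ^ m - 1) * (Q ^ m - ((Q - 1) * (N - 1) / N + 1) ^ m)" if "0 < m" for m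
    using avg_column_correctable_eq[OF assms(3,2,5,6,4) that assms(8) N1] Q assms(1)
    by (simp add: Q_def)
  have ratio: "real (num_row_correctable m k P) / avg_column_correctable m k P
      \<le> real k * N * (2 ^ ((k - 1) * k) / N) ^ m" if m: "0 < m" for m
  proof -
    define D where "D = Q ^ m - ((Q - 1) * (N - 1) / N + 1) ^ m"
    have D: "Q ^ m - 1 \<le> N * D" unfolding D_def by (rule geometric_comparison[OF Q N1])
    have Qm: "0 < Q ^ m - 1" using Q m by simp
    \<comment> \<open>The comparison also yields positivity of the bracket \<open>D\<close>, so
      dividing by it is legitimate.\<close>
    have "0 < N * D" using D Qm by linarith
    hence D0: "0 < D" using N1 by (simp add: zero_less_mult_iff)
    have "real (num_row_correctable m k P) = (2 ^ (m * k)) ^ k - (2 ^ (m * k) - 1) ^ k"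
      using row[OF m] by (simp add: mult.commute flip: power_mult)
    also have "\<dots> \<le> real k * (2 ^ (m * k)) ^ (k - 1)" by (rule power_diff_le) simp
    also have "\<dots> = real k * (2 ^ ((k - 1) * k)) ^ m" by (simp add: mult_ac flip: power_mult)
    finally have R: "real (num_row_correctable m k P) \<le> real k * (2 ^ ((k - 1) * k)) ^ m" .
    have "real (num_row_correctable m k P) / avg_column_correctable m k P
        = real (num_row_correctable m k P) * ((Q ^ m - 1) / D) / N ^ m"
      by (simp add: avg[OF m] flip: D_def)
    \<comment> \<open>The two factors are bounded separately: the row count by \<open>R\<close>, and
      \<open>(Q ^ m - 1) / D\<close> by \<open>N\<close>.\<close>
    also have "\<dots> \<le> real k * (2 ^ ((k - 1) * k)) ^ m * N / N ^ m"
    proof (intro divide_right_mono mult_mono R)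
      show "(Q ^ m - 1) / D \<le> N" using D D0 by (simp add: divide_le_eq)
    qed (use N1 Qm D0 in auto)
    finally show ?thesis by (simp add: power_divide mult_ac)
  qed
  have limit: "(\<lambda>m. real (num_row_correctable m k P) / avg_column_correctable m k P) \<longlonglongrightarrow> 0" if "2 \<le> k"
  proof (rule tendsto_sandwich[OF _ _ tendsto_const])
    have "(\<lambda>m. (2 ^ ((k - 1) * k) / N) ^ m) \<longlonglongrightarrow> 0"
      using small[OF that] N1 by (intro LIMSEQ_power_zero) (simp add: divide_less_eq)
    thus "(\<lambda>m. real k * N * (2 ^ ((k - 1) * k) / N) ^ m) \<longlonglongrightarrow> 0"
      by (rule tendsto_mult_right_zero)
    \<comment> \<open>The bound is available for positive \<open>m\<close> only, hence
      eventually.\<close>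
    show "\<forall>\<^sub>F m in sequentially. real (num_row_correctable m k P) / avg_column_correctable m k P
        \<le> real k * N * (2 ^ ((k - 1) * k) / N) ^ m"
      using eventually_gt_at_top[of 0] by (rule eventually_mono) (rule ratio)
    show "\<forall>\<^sub>F m in sequentially. 0 \<le> real (num_row_correctable m k P) / avg_column_correctable m k P"
      by (simp add: avg_column_correctable_def sum_nonneg)
  qed
  have Qm: "real q ^ (m * k) = Q ^ m" for m
    by (simp add: Q_def mult.commute flip: power_mult)
  have "real (num_row_correctable m k P) = 2 ^ (k * n) - (2 ^ n - 1) ^ k \<and>
      avg_column_correctable m k P = N ^ m / (real q ^ n - 1) *
        (real q ^ n - ((real q ^ k - 1) * (N - 1) / N + 1) ^ m)"
    if "0 < m" "n = m * k" for m n
    unfolding that(2) Qm unfolding Q_def[symmetric] using row[OF that(1)] avg[OF that(1)] by blast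
  thus ?thesis using ratio limit by blast
qed

end
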